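(* Let $G$ be a finitely generated amenable group and let $k\in\mathbb{N}$ with $k>0$. Then the $\ell^\infty$-semi-norm on $H^{\mathrm{uf}}_k(G;\mathbb{R})$ is trivial, i.e., $\|\alpha\|_\infty=0$ for all $\alpha\in H^{\mathrm{uf}}_k(G;\mathbb{R})$.
   Context: A finitely generated group $G$ is regarded as a metric space via the (left-invariant) word metric of some finite generating set; uniformly finite homology of $G$ and its $\ell^\infty$-semi-norm do not depend on this choice. Amenability of $G$ is the usual notion (existence of Følner sequences, equivalently of an invariant mean on $\ell^\infty(G,\mathbb{R})$). Uniformly finite homology: let $X$ be a metric space that is uniformly discrete (distances between distinct points bounded below by some $\varepsilon>0$) and of bounded geometry (for every $r>0$ the cardinalities of $r$-balls are uniformly bounded), e.g. $X=G$. Let $R=\mathbb{R}$ with the standard absolute value $|\cdot|$. For $n\in\mathbb{N}=\{0,1,2,\dots\}$, $C^{\mathrm{uf}}_n(X;R)$ is the $R$-module of functions $X^{n+1}\to R$, written as formal sums $c=\sum_{x\in X^{n+1}}c_x\cdot x$, such that $\sup_x|c_x|<\infty$ and there is a constant $\rho>0$ (depending on $c$) with $c_x=0$ whenever $x=(x_0,\dots,x_n)$ satisfies $\sup_{i,j}d(x_i,x_j)>\rho$. The boundary operator $\partial_n\colon C^{\mathrm{uf}}_n(X;R)\to C^{\mathrm{uf}}_{n-1}(X;R)$ is the extension to such (possibly infinite) sums of $(x_0,\dots,x_n)\mapsto\sum_{j=0}^n(-1)^j(x_0,\dots,\widehat{x_j},\dots,x_n)$ (and every $0$-chain is a cycle).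 $H^{\mathrm{uf}}_*(X;R)$ is the homology of this chain complex. The $\ell^\infty$-norm on chains is $\|\sum_x c_x\cdot x\|_\infty=\sup_x|c_x|$, and the $\ell^\infty$-semi-norm of $\alpha\in H^{\mathrm{uf}}_n(X;R)$ is $\|\alpha\|_\infty=\inf\{\|c\|_\infty : c\in C^{\mathrm{uf}}_n(X;R),\ \partial c=0,\ [c]=\alpha\}$. *)

theory Defs
  imports Complex_Main "HOL-Algebra.Generated_Groups"
begin

definition word_length :: "('a, 'b) monoid_scheme \<Rightarrow> 'a set \<Rightarrow> 'a \<Rightarrow> nat" where
  "word_length G S g =
     (LEAST n. \<exists>ws. length ws = n \<and> set ws \<subseteq> S \<union> (\<lambda>s. inv\<^bsub>G\<^esub> s) ` S \<and>
                    foldr (\<lambda>a b. a \<otimes>\<^bsub>G\<^esub> b) ws \<one>\<^bsub>G\<^esub> = g)"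

definition word_dist :: "('a, 'b) monoid_scheme \<Rightarrow> 'a set \<Rightarrow> 'a \<Rightarrow> 'a \<Rightarrow> real" where
  "word_dist G S x y = real (word_length G S (inv\<^bsub>G\<^esub> x \<otimes>\<^bsub>G\<^esub> y))"

text \<open>
  Elements of \<open>\<ell>\<^sup>\<infinity>(G, \<real>)\<close> are represented by functions on the whole type that are bounded on
  \<open>carrier G\<close>. By linearity and positivity, an invariant mean takes the same value on two such
  functions that agree on \<open>carrier G\<close>, so values outside the carrier are irrelevant.
\<close>

definition bounded_funs :: "('a, 'b) monoid_scheme \<Rightarrow> ('a \<Rightarrow> real) set" where
  "bounded_funs G = {f. \<exists>B. \<forall>x\<in>carrier G. \<bar>f x\<bar> \<le> B}"

definition invariant_mean :: "('a, 'b) monoid_scheme \<Rightarrow> (('a \<Rightarrow> real) \<Rightarrow> real) \<Rightarrow> bool" where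
  "invariant_mean G m \<longleftrightarrow>
     (\<forall>f\<in>bounded_funs G. \<forall>h\<in>bounded_funs G. m (\<lambda>x. f x + h x) = m f + m h) \<and>
     (\<forall>r. \<forall>f\<in>bounded_funs G. m (\<lambda>x. r * f x) = r * m f) \<and>
     m (\<lambda>x. 1) = 1 \<and>
     (\<forall>f\<in>bounded_funs G. (\<forall>x\<in>carrier G. 0 \<le> f x) \<longrightarrow> 0 \<le> m f) \<and>
     (\<forall>g\<in>carrier G. \<forall>f\<in>bounded_funs G. m (\<lambda>x. f (g \<otimes>\<^bsub>G\<^esub> x)) = m f)"

definition amenable :: "('a, 'b) monoid_scheme \<Rightarrow> bool" where
  "amenable G \<longleftrightarrow> (\<exists>m. invariant_mean G m)"

text \<open>
  Throughout, \<open>X\<close> is the underlying set of a uniformly discrete metric space of bounded geometry, with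
  metric \<open>d\<close>. Points of \<open>X\<^sup>n\<^sup>+\<^sup>1\<close> are lists of length \<open>n + 1\<close>, and functions on \<open>X\<^sup>n\<^sup>+\<^sup>1\<close> are
  extended by \<open>0\<close> to all lists.
\<close>

definition uf_tuples :: "'a set \<Rightarrow> nat \<Rightarrow> 'a list set" where
  "uf_tuples X n = {x. length x = Suc n \<and> set x \<subseteq> X}"

definition uf_chains :: "'a set \<Rightarrow> ('a \<Rightarrow> 'a \<Rightarrow> real) \<Rightarrow> nat \<Rightarrow> ('a list \<Rightarrow> real) set" where
  "uf_chains X d n =
     {c. (\<forall>x. x \<notin> uf_tuples X n \<longrightarrow> c x = 0) \<and>
         (\<exists>B. \<forall>x\<in>uf_tuples X n. \<bar>c x\<bar> \<le> B) \<and>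
         (\<exists>\<rho>>0. \<forall>x\<in>uf_tuples X n.
            (\<exists>i\<le>n. \<exists>j\<le>n. d (x ! i) (x ! j) > \<rho>) \<longrightarrow> c x = 0)}"

definition face :: "nat \<Rightarrow> 'a list \<Rightarrow> 'a list" where
  "face j x = take j x @ drop (Suc j) x"

text \<open>
  The coefficient of \<open>\<partial>c\<close> at \<open>y\<close> collects the coefficients \<open>c x\<close> of all simplices \<open>x\<close> having
  \<open>y\<close> as a face. For a chain \<open>c\<close> of degree \<open>n > 0\<close> the inner sums range over finite sets: all
  vertices of such an \<open>x\<close> in the support of \<open>c\<close> lie in a fixed ball around a vertex of \<open>y\<close>, and
  balls are finite by bounded geometry. The boundary of a \<open>0\<close>-chain is \<open>0\<close>.
\<close>

definition uf_boundary :: "'a set \<Rightarrow> nat \<Rightarrow> ('a list \<Rightarrow> real) \<Rightarrow> 'a list \<Rightarrow> real" where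
  "uf_boundary X n c =
     (if n = 0 then (\<lambda>y. 0)
      else (\<lambda>y. \<Sum>j\<le>n. (- 1) ^ j * (\<Sum>x \<in> {x \<in> uf_tuples X n. c x \<noteq> 0 \<and> face j x = y}. c x)))"

definition uf_cycles :: "'a set \<Rightarrow> ('a \<Rightarrow> 'a \<Rightarrow> real) \<Rightarrow> nat \<Rightarrow> ('a list \<Rightarrow> real) set" where
  "uf_cycles X d n = {c \<in> uf_chains X d n. uf_boundary X n c = (\<lambda>y. 0)}"

definition uf_boundaries :: "'a set \<Rightarrow> ('a \<Rightarrow> 'a \<Rightarrow> real) \<Rightarrow> nat \<Rightarrow> ('a list \<Rightarrow> real) set" where
  "uf_boundaries X d n = uf_boundary X (Suc n) ` uf_chains X d (Suc n)"

definition uf_cycle_group ::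
    "'a set \<Rightarrow> ('a \<Rightarrow> 'a \<Rightarrow> real) \<Rightarrow> nat \<Rightarrow> ('a list \<Rightarrow> real) monoid" where
  "uf_cycle_group X d n =
     \<lparr>carrier = uf_cycles X d n, monoid.mult = (\<lambda>c c' x. c x + c' x), one = (\<lambda>x. 0)\<rparr>"

definition uf_homology ::
    "'a set \<Rightarrow> ('a \<Rightarrow> 'a \<Rightarrow> real) \<Rightarrow> nat \<Rightarrow> ('a list \<Rightarrow> real) set monoid" where
  "uf_homology X d n = uf_cycle_group X d n Mod uf_boundaries X d n"

definition uf_class ::
    "'a set \<Rightarrow> ('a \<Rightarrow> 'a \<Rightarrow> real) \<Rightarrow> nat \<Rightarrow> ('a list \<Rightarrow> real) \<Rightarrow> ('a list \<Rightarrow> real) set" where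
  "uf_class X d n c = uf_boundaries X d n #>\<^bsub>uf_cycle_group X d n\<^esub> c"

definition uf_norm :: "'a set \<Rightarrow> nat \<Rightarrow> ('a list \<Rightarrow> real) \<Rightarrow> real" where
  "uf_norm X n c = (SUP x\<in>uf_tuples X n. \<bar>c x\<bar>)"

definition uf_seminorm ::
    "'a set \<Rightarrow> ('a \<Rightarrow> 'a \<Rightarrow> real) \<Rightarrow> nat \<Rightarrow> ('a list \<Rightarrow> real) set \<Rightarrow> real" where
  "uf_seminorm X d n \<alpha> = Inf {uf_norm X n c | c. c \<in> uf_cycles X d n \<and> uf_class X d n c = \<alpha>}"

end

theory Submission
  imports Defs
begin

text \<open>
  Let \<open>c\<close> be a uniformly finite cycle of degree \<open>k > 0\<close>. For a finite nonempty set
  \<open>F \<subseteq> G\<close>, cone off every simplex by a vertex near its first vertex, averaging over the possible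
  cone points:
  \<open>K (x_0, \<dots>, x_k) = 1/|F| \<Sum>f\<in>F. (x_0 f, x_0, \<dots>, x_k)\<close>.
  Right translations move points by a bounded distance, so \<open>K c\<close> is again a uniformly finite chain.
  As \<open>c\<close> is a cycle, the faces of \<open>K c\<close> that drop one of \<open>x_1, \<dots>, x_k\<close> add up to a
  multiple of the face that drops \<open>x_0\<close> from \<open>c\<close>, and the
  cycle \<open>c - \<partial> K c\<close>, which is homologous to \<open>c\<close>, is obtained from \<open>c\<close> by
  \<open>(x_0, \<dots>, x_k) \<mapsto> 1/|F| \<Sum>f\<in>F. (x_0 f, x_1, \<dots>, x_k) - (x_1 f, x_1, \<dots>, x_k)\<close>.
  So the first vertex has been spread over a translate of \<open>F\<close>. Only boundedly many simplices in
  the support of \<open>c\<close> share the vertices \<open>x_1, \<dots>, x_k\<close>, because \<open>k > 0\<close> pins \<open>x_0\<close> to a ball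
  around \<open>x_1\<close>. Each of them contributes at most \<open>\<parallel>c\<parallel> / |F|\<close> to a given coefficient, whence
  the norm of the new cycle is \<open>O(1 / |F|)\<close> uniformly in \<open>F\<close>. If \<open>G\<close> is infinite, \<open>|F|\<close> can be
  taken arbitrarily large. If \<open>G\<close> is finite, then for \<open>F = G\<close> both averages agree and the new
  cycle is \<open>0\<close>.

  The combinatorial core is \<open>cycle_minus_boundary_spread_cone\<close>, and
  \<open>cycle_homologous_small\<close> draws the estimate from it. To manipulate the infinite sums safely,
  each coefficient of a boundary is computed within a finite set of vertices
  (\<open>uf_boundary_eq_boundary_within\<close>). There the boundary operator obeys a recursion on lists
  that yields the algebraic identities without any finiteness conditions.
\<close>

section \<open>The boundary operator with insertions from a finite set\<close>

text \<open>
  The coefficient of \<open>\<partial>c\<close> at \<open>y\<close> if only simplices arising from \<open>y\<close> by inserting a vertex of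
  \<open>A\<close> are taken into account. Splitting off the insertion in front of the first vertex gives a recursion in
  which the first vertex \<open>v\<close> turns into a fixed parameter: the remaining insertions form the
  boundary coefficient at the tail of the chain \<open>x \<mapsto> c (v # x)\<close>, with the signs reversed.
\<close>

primrec boundary_within :: "'a set \<Rightarrow> ('a list \<Rightarrow> real) \<Rightarrow> 'a list \<Rightarrow> real" where
  "boundary_within A c [] = (\<Sum>a\<in>A. c [a])"
| "boundary_within A c (v # t) = (\<Sum>a\<in>A. c (a # v # t)) - boundary_within A (\<lambda>x. c (v # x)) t"

text \<open>
  Insertion keeps the vertices of \<open>y\<close>. This is what allows one finite set \<open>A\<close>, chosen from a
  single vertex of \<open>y\<close>, to serve for iterated boundaries at \<open>y\<close> as well.
\<close>
lemma boundary_within_cong: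
  assumes "\<And>x. set y \<subseteq> set x \<Longrightarrow> length x = Suc (length y) \<Longrightarrow> c x = c' x"
  shows "boundary_within A c y = boundary_within A c' y"
  using assms
proof (induction y arbitrary: c c')
  case Nil
  then show ?case by (auto intro!: sum.cong)
next
  case (Cons v t)
  have "boundary_within A (\<lambda>x. c (v # x)) t = boundary_within A (\<lambda>x. c' (v # x)) t"
    by (rule Cons.IH) (auto intro!: Cons.prems)
  moreover have "(\<Sum>a\<in>A. c (a # v # t)) = (\<Sum>a\<in>A. c' (a # v # t))"
    by (intro sum.cong refl Cons.prems) auto
  ultimately show ?case by simp
qed

lemma boundary_within_diff: "boundary_within A (\<lambda>x. f x - g x) y = boundary_within A f y - boundary_within A g y"
  by (induction y arbitrary: f g) (simp_all add: sum_subtractf)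

lemma boundary_within_scale: "boundary_within A (\<lambda>x. r * f x) y = r * boundary_within A f y"
  by (induction y arbitrary: f) (simp_all add: sum_distrib_left right_diff_distrib)

lemma boundary_within_sum: "boundary_within A (\<lambda>x. \<Sum>b\<in>I. f b x) y = (\<Sum>b\<in>I. boundary_within A (f b) y)"
proof (induction y arbitrary: f)
  case Nil
  show ?case by (simp, rule sum.swap)
next
  case (Cons v t)
  show ?case by (simp add: Cons.IH sum_subtractf, rule sum.swap)
qed

text \<open>
  In the inductive step, the two ways of inserting a pair of vertices in front of the first one
  cancel by exchanging the two sums, the terms with one insertion in front and one behind cancel
  by linearity, and the induction hypothesis deals with both insertions behind.
\<close>
lemma boundary_within_boundary_within: "boundary_within A (boundary_within A c) y = 0"
proof (induction y arbitrary: c)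
  case Nil
  have "(\<Sum>a\<in>A. \<Sum>b\<in>A. c [b, a]) = (\<Sum>a\<in>A. \<Sum>b\<in>A. c [a, b])"
    by (rule sum.swap)
  then show ?case by (simp add: sum_subtractf)
next
  case (Cons v t)
  have swap: "(\<Sum>a\<in>A. \<Sum>b\<in>A. c (b # a # v # t)) = (\<Sum>a\<in>A. \<Sum>b\<in>A. c (a # b # v # t))"
    by (rule sum.swap)
  have "boundary_within A (\<lambda>x. boundary_within A c (v # x)) t
      = boundary_within A (\<lambda>x. \<Sum>a\<in>A. c (a # v # x)) t - boundary_within A (boundary_within A (\<lambda>x. c (v # x))) t"
    by (simp add: boundary_within_diff)
  also have "\<dots> = (\<Sum>a\<in>A. boundary_within A (\<lambda>x. c (a # v # x)) t)"
    by (simp only: Cons.IH boundary_within_sum diff_zero)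
  finally show ?case using swap by (simp add: sum_subtractf)
qed

lemma boundary_within_eq_alternating_sum:
  "boundary_within A c y = (\<Sum>j\<le>length y. (- 1) ^ j * (\<Sum>a\<in>A. c (take j y @ a # drop j y)))"
proof (induction y arbitrary: c)
  case Nil
  show ?case by simp
next
  case (Cons v t)
  have "(\<Sum>j\<le>length (v # t). (- 1) ^ j * (\<Sum>a\<in>A. c (take j (v # t) @ a # drop j (v # t))))
     = (\<Sum>a\<in>A. c (a # v # t))
       + (\<Sum>j\<le>length t. (- 1) ^ Suc j * (\<Sum>a\<in>A. c (v # take j t @ a # drop j t)))"
    by (simp only: list.size(4) add_Suc_right add_0_right sum.atMost_Suc_shift) simp
  also have "\<dots> = boundary_within A c (v # t)"
    by (simp add: Cons.IH sum_negf)
  finally show ?case by simp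
qed

text \<open>
  The boundary of a weighted cone: the first vertex of each simplex is a cone point with a weight
  depending on it and on the next vertex. Inserting beyond the second vertex does not affect the
  weight, so these insertions add up to \<open>w v u\<close> times a boundary coefficient of \<open>c\<close> without its
  leading term.
\<close>
lemma boundary_within_cone:
  "boundary_within A (\<lambda>x. w (hd x) (hd (tl x)) * c (tl x)) (v # u # s)
     = (\<Sum>a\<in>A. w a v) * c (v # u # s) + w v u * (\<Sum>a\<in>A. c (a # u # s))
       - (\<Sum>a\<in>A. w v a * c (a # u # s)) - w v u * boundary_within A c (u # s)"
proof -
  have "boundary_within A (\<lambda>x. w (hd x) (hd (tl x)) * c (tl x)) (v # u # s)
     = (\<Sum>a\<in>A. w a v) * c (v # u # s) - (\<Sum>a\<in>A. w v a * c (a # u # s))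
       + w v u * boundary_within A (\<lambda>x. c (u # x)) s"
    by (simp add: boundary_within_scale sum_distrib_right)
  then show ?thesis by (simp add: algebra_simps)
qed

section \<open>Uniformly finite chains on a group\<close>

text \<open>
  Uniformly finite chains with explicit bounds. A bound on the diameter of simplices is replaced by a
  finite set \<open>E\<close> containing all differences \<open>x_i\<^sup>-\<^sup>1 x_j\<close>. As word balls are finite, this is the same
  notion (see \<open>uf_chains_iff_controlled\<close>), and it replaces the triangle inequality
  by multiplication in the group.
\<close>
definition controlled_chain ::
    "('a, 'b) monoid_scheme \<Rightarrow> nat \<Rightarrow> real \<Rightarrow> 'a set \<Rightarrow> ('a list \<Rightarrow> real) \<Rightarrow> bool" where
  "controlled_chain G n B E c \<longleftrightarrow>
     (\<forall>x. x \<notin> uf_tuples (carrier G) n \<longrightarrow> c x = 0) \<and> (\<forall>x. \<bar>c x\<bar> \<le> B) \<and>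
     finite E \<and> E \<subseteq> carrier G \<and>
     (\<forall>x. c x \<noteq> 0 \<longrightarrow> (\<forall>a\<in>set x. \<forall>b\<in>set x. inv\<^bsub>G\<^esub> a \<otimes>\<^bsub>G\<^esub> b \<in> E))"

lemma controlled_chainD:
  assumes "controlled_chain G n B E c"
  shows "x \<notin> uf_tuples (carrier G) n \<Longrightarrow> c x = 0" "\<bar>c x\<bar> \<le> B" "finite E" "E \<subseteq> carrier G"
    "c x \<noteq> 0 \<Longrightarrow> a \<in> set x \<Longrightarrow> b \<in> set x \<Longrightarrow> inv\<^bsub>G\<^esub> a \<otimes>\<^bsub>G\<^esub> b \<in> E"
  using assms unfolding controlled_chain_def by blast+

lemma controlled_chain_nonneg: "controlled_chain G n B E c \<Longrightarrow> 0 \<le> B"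
  using controlled_chainD(2)[of G n B E c undefined] by linarith

lemma controlled_chain_diff:
  assumes "controlled_chain G n B E c" "controlled_chain G n B' E' c'"
  shows "controlled_chain G n (B + B') (E \<union> E') (\<lambda>x. c x - c' x)"
proof -
  have "\<bar>c x - c' x\<bar> \<le> B + B'" for x
    using controlled_chainD(2)[OF assms(1), of x] controlled_chainD(2)[OF assms(2), of x] by linarith
  moreover have "inv\<^bsub>G\<^esub> a \<otimes>\<^bsub>G\<^esub> b \<in> E \<union> E'"
    if "c x - c' x \<noteq> 0" "a \<in> set x" "b \<in> set x" for x a b
    using that controlled_chainD(5)[OF assms(1), of x a b] controlled_chainD(5)[OF assms(2), of x a b]
    by (cases "c x = 0") auto
  ultimately show ?thesis
    using controlled_chainD(1,3,4)[OF assms(1)] controlled_chainD(1,3,4)[OF assms(2)]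
    unfolding controlled_chain_def by auto
qed

context group
begin

lemma mult_inv_mult_cancel: "p \<in> carrier G \<Longrightarrow> a \<in> carrier G \<Longrightarrow> p \<otimes> (inv p \<otimes> a) = a"
  by (simp add: m_assoc[symmetric])

lemma inv_mult_mult_cancel: "p \<in> carrier G \<Longrightarrow> a \<in> carrier G \<Longrightarrow> inv p \<otimes> (p \<otimes> a) = a"
  by (simp add: m_assoc[symmetric])

lemma generated_by_word:
  assumes "S \<subseteq> carrier G" "g \<in> generate G S"
  shows "\<exists>ws. set ws \<subseteq> S \<union> (\<lambda>s. inv s) ` S \<and> foldr (\<lambda>a b. a \<otimes> b) ws \<one> = g"
proof -
  have foldr_closed: "foldr (\<lambda>a b. a \<otimes> b) ws \<one> \<in> carrier G" if "set ws \<subseteq> carrier G" for ws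
    using that by (induction ws) auto
  have foldr_append: "foldr (\<lambda>a b. a \<otimes> b) (ws @ vs) \<one>
      = foldr (\<lambda>a b. a \<otimes> b) ws \<one> \<otimes> foldr (\<lambda>a b. a \<otimes> b) vs \<one>"
    if "set ws \<subseteq> carrier G" "set vs \<subseteq> carrier G" for ws vs
    using that(1)
  proof (induction ws)
    case Nil
    then show ?case using foldr_closed[OF that(2)] by simp
  next
    case (Cons a ws)
    then show ?case
      using foldr_closed[OF that(2)] foldr_closed[of ws] m_assoc by (auto simp: m_assoc)
  qed
  have sub: "S \<union> (\<lambda>s. inv s) ` S \<subseteq> carrier G" using assms(1) by auto
  from assms(2) show ?thesis
  proof (induction rule: generate.induct)
    case one
    show ?case by (intro exI[of _ "[]"]) simp
  next
    case (incl h)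
    then show ?case using assms(1) by (intro exI[of _ "[h]"]) auto
  next
    case (inv h)
    then show ?case using assms(1) by (intro exI[of _ "[inv h]"]) auto
  next
    case (eng h1 h2)
    then obtain ws vs where
      "set ws \<subseteq> S \<union> (\<lambda>s. inv s) ` S" "foldr (\<lambda>a b. a \<otimes> b) ws \<one> = h1"
      "set vs \<subseteq> S \<union> (\<lambda>s. inv s) ` S" "foldr (\<lambda>a b. a \<otimes> b) vs \<one> = h2" by blast
    then show ?case using foldr_append[of ws vs] sub by (intro exI[of _ "ws @ vs"]) auto
  qed
qed

lemma finite_word_ball:
  assumes "finite S" "S \<subseteq> carrier G" "generate G S = carrier G"
  shows "finite {g \<in> carrier G. word_length G S g \<le> m}"
proof -
  let ?T = "S \<union> (\<lambda>s. inv s) ` S"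
  have "{g \<in> carrier G. word_length G S g \<le> m}
     \<subseteq> (\<lambda>ws. foldr (\<lambda>a b. a \<otimes> b) ws \<one>) ` {ws. set ws \<subseteq> ?T \<and> length ws \<le> m}"
  proof
    fix g assume g: "g \<in> {g \<in> carrier G. word_length G S g \<le> m}"
    let ?P = "\<lambda>n. \<exists>ws. length ws = n \<and> set ws \<subseteq> ?T \<and> foldr (\<lambda>a b. a \<otimes> b) ws \<one> = g"
    have "\<exists>n. ?P n" using generated_by_word[of S g] assms g by auto
    then have "?P (word_length G S g)" unfolding word_length_def by (rule LeastI_ex)
    then show "g \<in> (\<lambda>ws. foldr (\<lambda>a b. a \<otimes> b) ws \<one>) ` {ws. set ws \<subseteq> ?T \<and> length ws \<le> m}"
      using g by auto
  qed
  then show ?thesis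
    using finite_lists_length_le[of ?T m] assms(1) by (auto intro: finite_subset)
qed

lemma uf_chains_iff_controlled:
  assumes "finite S" "S \<subseteq> carrier G" "generate G S = carrier G"
  shows "c \<in> uf_chains (carrier G) (word_dist G S) n \<longleftrightarrow> (\<exists>B E. controlled_chain G n B E c)"
proof
  assume c: "c \<in> uf_chains (carrier G) (word_dist G S) n"
  have supp: "\<forall>x. x \<notin> uf_tuples (carrier G) n \<longrightarrow> c x = 0"
    using c unfolding uf_chains_def by blast
  obtain B where B: "\<forall>x\<in>uf_tuples (carrier G) n. \<bar>c x\<bar> \<le> B"
    using c unfolding uf_chains_def by blast
  obtain \<rho> where \<rho>: "\<forall>x\<in>uf_tuples (carrier G) n.
      (\<exists>i\<le>n. \<exists>j\<le>n. word_dist G S (x ! i) (x ! j) > \<rho>) \<longrightarrow> c x = 0"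
    using c unfolding uf_chains_def by blast
  let ?E = "{g \<in> carrier G. word_length G S g \<le> nat \<lfloor>\<rho>\<rfloor>}"
  have "inv a \<otimes> b \<in> ?E" if x: "c x \<noteq> 0" "a \<in> set x" "b \<in> set x" for x a b
  proof -
    have t: "x \<in> uf_tuples (carrier G) n" using supp x(1) by blast
    then have l: "length x = Suc n" "set x \<subseteq> carrier G" by (auto simp: uf_tuples_def)
    obtain i j where "i \<le> n" "a = x ! i" "j \<le> n" "b = x ! j"
      using x l by (auto simp: in_set_conv_nth less_Suc_eq_le)
    then have "word_dist G S a b \<le> \<rho>" using \<rho> t x(1) by force
    then have "word_length G S (inv a \<otimes> b) \<le> nat \<lfloor>\<rho>\<rfloor>"
      unfolding word_dist_def by (simp add: le_nat_floor)
    then show ?thesis using l x by auto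
  qed
  moreover have "\<bar>c x\<bar> \<le> max B 0" for x
    using supp B by (cases "x \<in> uf_tuples (carrier G) n") (auto simp: le_max_iff_disj)
  ultimately have "controlled_chain G n (max B 0) ?E c"
    using supp finite_word_ball[OF assms] unfolding controlled_chain_def by blast
  then show "\<exists>B E. controlled_chain G n B E c" by blast
next
  assume "\<exists>B E. controlled_chain G n B E c"
  then obtain B E where c: "controlled_chain G n B E c" by blast
  let ?\<rho> = "real (Max (insert 0 (word_length G S ` E))) + 1"
  have fin: "finite (insert 0 (word_length G S ` E))" using controlled_chainD(3)[OF c] by simp
  have "c x = 0" if x: "x \<in> uf_tuples (carrier G) n" "i \<le> n" "j \<le> n"
      "word_dist G S (x ! i) (x ! j) > ?\<rho>" for x i j
  proof (rule ccontr)
    assume "c x \<noteq> 0"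
    then have "inv (x ! i) \<otimes> (x ! j) \<in> E"
      using controlled_chainD(5)[OF c] x by (auto simp: uf_tuples_def)
    then have "word_length G S (inv (x ! i) \<otimes> (x ! j)) \<le> Max (insert 0 (word_length G S ` E))"
      using fin by (intro Max_ge) auto
    then show False using x(4) unfolding word_dist_def by linarith
  qed
  then have "\<exists>\<rho>>0. \<forall>x\<in>uf_tuples (carrier G) n.
      (\<exists>i\<le>n. \<exists>j\<le>n. word_dist G S (x ! i) (x ! j) > \<rho>) \<longrightarrow> c x = 0"
    by (intro exI[of _ ?\<rho>]) auto
  then show "c \<in> uf_chains (carrier G) (word_dist G S) n"
    using controlled_chainD(1,2)[OF c] unfolding uf_chains_def by blast
qed

text \<open>
  All vertices of a simplex in the support of \<open>c\<close> with face \<open>y\<close> lie in \<open>p E\<close> for any vertex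
  \<open>p\<close> of \<open>y\<close>.
\<close>
lemma uf_boundary_eq_boundary_within:
  assumes c: "controlled_chain G (Suc n) B E c" and y: "length y = Suc n" "p \<in> set y"
    and A: "finite A" "(\<lambda>e. p \<otimes> e) ` E \<subseteq> A"
  shows "uf_boundary (carrier G) (Suc n) c y = boundary_within A c y"
proof -
  have "(\<Sum>x \<in> {x \<in> uf_tuples (carrier G) (Suc n). c x \<noteq> 0 \<and> face j x = y}. c x)
      = (\<Sum>a\<in>A. c (take j y @ a # drop j y))" (is "sum c ?X = _") if j: "j \<le> Suc n" for j
  proof -
    let ?ins = "\<lambda>a. take j y @ a # drop j y"
    have len: "length (take j y) = j" using j y by simp
    have inj: "inj_on ?ins A" by (rule inj_onI) simp
    have sub: "?X \<subseteq> ?ins ` A"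
    proof
      fix x assume x: "x \<in> ?X"
      then have l: "length x = Suc (Suc n)" "set x \<subseteq> carrier G" by (auto simp: uf_tuples_def)
      have yx: "y = take j x @ drop (Suc j) x" using x by (auto simp: face_def)
      have "take j y = take j x" "drop j y = drop (Suc j) x" using j l yx by auto
      then have xi: "x = ?ins (x ! j)" using j l id_take_nth_drop[of j x] by simp
      have "set y \<subseteq> set x" using yx set_take_subset[of j x] set_drop_subset[of "Suc j" x] by auto
      then have px: "p \<in> set x" "x ! j \<in> set x" using y j l by auto
      then have "inv p \<otimes> (x ! j) \<in> E" using controlled_chainD(5)[OF c] x by auto
      moreover have "x ! j = p \<otimes> (inv p \<otimes> (x ! j))"
        using px l by (simp add: mult_inv_mult_cancel subset_iff)
      ultimately have "x ! j \<in> A" using A(2) by blast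
      then show "x \<in> ?ins ` A" using xi by blast
    qed
    \<comment> \<open>Such an insertion has the right face, so it is no simplex over \<open>G\<close> or has coefficient \<open>0\<close>.\<close>
    have zero: "c x = 0" if x: "x \<in> ?ins ` A - ?X" for x
    proof -
      have "face j x = y" using x len by (auto simp: face_def)
      then show ?thesis using x controlled_chainD(1)[OF c, of x] by blast
    qed
    have "sum c ?X = sum c (?ins ` A)"
      by (rule sum.mono_neutral_left[OF finite_imageI[OF A(1)] sub]) (use zero in blast)
    also have "\<dots> = (\<Sum>a\<in>A. c (?ins a))"
      by (simp only: sum.reindex[OF inj] o_def)
    finally show ?thesis .
  qed
  then show ?thesis
    unfolding uf_boundary_def boundary_within_eq_alternating_sum y(1)
    by (simp cong: sum.cong_simp)
qed

lemma uf_boundary_nonzeroD: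
  assumes "uf_boundary X (Suc n) c y \<noteq> 0"
  obtains x where "x \<in> uf_tuples X (Suc n)" "c x \<noteq> 0" "set y \<subseteq> set x" "y \<in> uf_tuples X n"
proof -
  obtain j where j: "j \<le> Suc n"
    "(- 1) ^ j * (\<Sum>x \<in> {x \<in> uf_tuples X (Suc n). c x \<noteq> 0 \<and> face j x = y}. c x) \<noteq> 0"
    using assms unfolding uf_boundary_def if_not_P[OF nat.distinct(2)]
    by (rule sum.not_neutral_contains_not_neutral) simp
  then have "(\<Sum>x \<in> {x \<in> uf_tuples X (Suc n). c x \<noteq> 0 \<and> face j x = y}. c x) \<noteq> 0" by simp
  then obtain x where x: "x \<in> uf_tuples X (Suc n)" "c x \<noteq> 0" "face j x = y"
    by (rule sum.not_neutral_contains_not_neutral) blast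
  have "set y \<subseteq> set x"
    using x(3) set_take_subset[of j x] set_drop_subset[of "Suc j" x] by (auto simp: face_def)
  moreover have "length y = Suc n" using x j by (auto simp: face_def uf_tuples_def)
  ultimately show ?thesis using x that by (auto simp: uf_tuples_def)
qed

lemma uf_boundary_outside:
  "y \<notin> uf_tuples X n \<Longrightarrow> uf_boundary X (Suc n) c y = 0"
  using uf_boundary_nonzeroD by metis

lemma controlled_chain_boundary:
  assumes c: "controlled_chain G (Suc n) B E c"
  shows "\<exists>B'. controlled_chain G n B' E (uf_boundary (carrier G) (Suc n) c)"
proof -
  let ?B = "real (Suc (Suc n)) * (real (card E) * B)"
  have E: "finite E" using controlled_chainD(3)[OF c] .
  have B: "0 \<le> B" using controlled_chain_nonneg[OF c] .
  have bound: "\<bar>uf_boundary (carrier G) (Suc n) c y\<bar> \<le> ?B" for y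
  proof (cases "length y = Suc n")
    case True
    let ?A = "(\<lambda>e. hd y \<otimes> e) ` E"
    have "hd y \<in> set y" using True by (cases y) auto
    then have "uf_boundary (carrier G) (Suc n) c y = boundary_within ?A c y"
      by (rule uf_boundary_eq_boundary_within[OF c True]) (use E in auto)
    also have "\<dots> = (\<Sum>j\<le>Suc n. (- 1) ^ j * (\<Sum>a\<in>?A. c (take j y @ a # drop j y)))"
      by (simp add: boundary_within_eq_alternating_sum True)
    also have "\<bar>\<dots>\<bar> \<le> (\<Sum>j\<le>Suc n. real (card E) * B)"
    proof (rule order_trans[OF sum_abs sum_mono])
      fix j
      have "\<bar>\<Sum>a\<in>?A. c (take j y @ a # drop j y)\<bar> \<le> (\<Sum>a\<in>?A. B)"
        by (rule order_trans[OF sum_abs sum_mono]) (rule controlled_chainD(2)[OF c])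
      also have "\<dots> \<le> real (card E) * B"
        using card_image_le[OF E, of "\<lambda>e. hd y \<otimes> e"] B by (simp add: mult_right_mono)
      finally show "\<bar>(- 1) ^ j * (\<Sum>a\<in>?A. c (take j y @ a # drop j y))\<bar> \<le> real (card E) * B"
        by (simp add: abs_mult power_abs)
    qed
    finally show ?thesis by (simp add: distrib_right)
  next
    case False
    then have "uf_boundary (carrier G) (Suc n) c y = 0"
      by (intro uf_boundary_outside) (simp add: uf_tuples_def)
    then show ?thesis using B by simp
  qed
  have "controlled_chain G n ?B E (uf_boundary (carrier G) (Suc n) c)"
    unfolding controlled_chain_def
  proof (intro conjI allI impI ballI)
    show "uf_boundary (carrier G) (Suc n) c y = 0" if "y \<notin> uf_tuples (carrier G) n" for y
      using that by (rule uf_boundary_outside)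
    show "inv a \<otimes> b \<in> E"
      if "uf_boundary (carrier G) (Suc n) c y \<noteq> 0" "a \<in> set y" "b \<in> set y" for y a b
      using that(1) by (rule uf_boundary_nonzeroD) (use that controlled_chainD(5)[OF c] in blast)
  qed (use bound E controlled_chainD(4)[OF c] in auto)
  then show ?thesis by blast
qed

lemma uf_boundary_diff:
  assumes c: "controlled_chain G (Suc n) B E c" and c': "controlled_chain G (Suc n) B' E' c'"
  shows "uf_boundary (carrier G) (Suc n) (\<lambda>x. c x - c' x)
       = (\<lambda>y. uf_boundary (carrier G) (Suc n) c y - uf_boundary (carrier G) (Suc n) c' y)"
proof
  fix y
  show "uf_boundary (carrier G) (Suc n) (\<lambda>x. c x - c' x) y
       = uf_boundary (carrier G) (Suc n) c y - uf_boundary (carrier G) (Suc n) c' y"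
  proof (cases "length y = Suc n")
    case True
    let ?A = "(\<lambda>e. hd y \<otimes> e) ` (E \<union> E')"
    have hd: "hd y \<in> set y" using True by (cases y) auto
    have A: "finite ?A" using controlled_chainD(3)[OF c] controlled_chainD(3)[OF c'] by simp
    show ?thesis
      using uf_boundary_eq_boundary_within[OF c True hd A] uf_boundary_eq_boundary_within[OF c' True hd A]
        uf_boundary_eq_boundary_within[OF controlled_chain_diff[OF c c'] True hd A]
      by (simp add: boundary_within_diff image_Un)
  next
    case False
    then have "uf_boundary (carrier G) (Suc n) f y = 0" for f
      by (intro uf_boundary_outside) (simp add: uf_tuples_def)
    then show ?thesis by simp
  qed
qed

lemma uf_boundary_boundary:
  assumes c: "controlled_chain G (Suc (Suc n)) B E c"
  shows "uf_boundary (carrier G) (Suc n) (uf_boundary (carrier G) (Suc (Suc n)) c) = (\<lambda>y. 0)"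
proof
  fix y
  let ?d = "uf_boundary (carrier G) (Suc (Suc n)) c"
  show "uf_boundary (carrier G) (Suc n) ?d y = 0"
  proof (cases "length y = Suc n")
    case True
    let ?A = "(\<lambda>e. hd y \<otimes> e) ` E"
    have hd: "hd y \<in> set y" using True by (cases y) auto
    have A: "finite ?A" using controlled_chainD(3)[OF c] by simp
    obtain B' where d: "controlled_chain G (Suc n) B' E ?d"
      using controlled_chain_boundary[OF c] by blast
    have "uf_boundary (carrier G) (Suc n) ?d y = boundary_within ?A ?d y"
      by (rule uf_boundary_eq_boundary_within[OF d True hd A]) simp
    also have "\<dots> = boundary_within ?A (boundary_within ?A c) y"
      by (rule boundary_within_cong, rule uf_boundary_eq_boundary_within[OF c _ _ A]) (use hd True in auto)
    finally show ?thesis by (simp add: boundary_within_boundary_within)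
  next
    case False
    then show ?thesis
      by (intro uf_boundary_outside) (simp add: uf_tuples_def)
  qed
qed

section \<open>Coning off along a finite set of translations\<close>

text \<open>
  The probability of reaching \<open>v\<close> from \<open>u\<close> by right multiplication with a uniformly random element
  of \<open>F\<close>.
\<close>
definition step_weight :: "'a set \<Rightarrow> 'a \<Rightarrow> 'a \<Rightarrow> real" where
  "step_weight F v u = (if inv u \<otimes> v \<in> F then 1 / real (card F) else 0)"

text \<open>
  The operator \<open>K\<close> on chains: the coefficient at \<open>(v, x_0, \<dots>, x_n)\<close> is that at
  \<open>(x_0, \<dots>, x_n)\<close> times the probability of choosing the cone point \<open>v\<close>.
\<close>
definition spread_cone :: "'a set \<Rightarrow> nat \<Rightarrow> ('a list \<Rightarrow> real) \<Rightarrow> 'a list \<Rightarrow> real" where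
  "spread_cone F n c x =
     (if x \<in> uf_tuples (carrier G) (Suc n) then step_weight F (hd x) (hd (tl x)) * c (tl x) else 0)"

lemma step_weight_bounds: "0 \<le> step_weight F v u" "step_weight F v u \<le> 1 / real (card F)"
  by (auto simp: step_weight_def)

lemma sum_step_weight:
  assumes F: "finite F" "F \<noteq> {}" "F \<subseteq> carrier G" and v: "v \<in> carrier G"
    and A: "finite A" "A \<subseteq> carrier G" "(\<lambda>f. v \<otimes> f) ` F \<subseteq> A"
  shows "(\<Sum>a\<in>A. step_weight F a v) = 1"
proof -
  have "(\<Sum>a\<in>A. step_weight F a v) = (\<Sum>a\<in>(\<lambda>f. v \<otimes> f) ` F. step_weight F a v)"
  proof (rule sum.mono_neutral_right[OF A(1,3)], rule ballI)
    fix a assume a: "a \<in> A - (\<lambda>f. v \<otimes> f) ` F"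
    then have "a = v \<otimes> (inv v \<otimes> a)"
      using v A(2) by (simp add: mult_inv_mult_cancel subset_iff)
    then have "inv v \<otimes> a \<notin> F" using a by blast
    then show "step_weight F a v = 0" by (simp add: step_weight_def)
  qed
  also have "\<dots> = (\<Sum>f\<in>F. step_weight F (v \<otimes> f) v)"
    using v F(3) by (subst sum.reindex) (auto intro!: inj_onI simp: subset_iff)
  also have "\<dots> = (\<Sum>f\<in>F. 1 / real (card F))"
  proof (rule sum.cong[OF refl])
    fix f assume "f \<in> F"
    then have "inv v \<otimes> (v \<otimes> f) \<in> F"
      using v F(3) by (simp add: inv_mult_mult_cancel subset_iff)
    then show "step_weight F (v \<otimes> f) v = 1 / real (card F)" by (simp add: step_weight_def)
  qed
  also have "\<dots> = 1" using F(1,2) by simp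
  finally show ?thesis .
qed

lemma controlled_chain_spread_cone:
  assumes c: "controlled_chain G n B E c" and F: "finite F" "F \<noteq> {}" "F \<subseteq> carrier G"
  shows "\<exists>E'. controlled_chain G (Suc n) B E' (spread_cone F n c)"
proof -
  let ?E = "insert \<one> (E \<union> (\<lambda>(e, f). e \<otimes> f) ` (E \<times> F) \<union> (\<lambda>(f, e). inv f \<otimes> e) ` (F \<times> E))"
  have "controlled_chain G (Suc n) B ?E (spread_cone F n c)"
    unfolding controlled_chain_def
  proof (intro conjI allI impI ballI)
    show "finite ?E" using F controlled_chainD(3)[OF c] by simp
    show "?E \<subseteq> carrier G" using F controlled_chainD(4)[OF c] by auto
    show "spread_cone F n c x = 0" if "x \<notin> uf_tuples (carrier G) (Suc n)" for x
      using that by (simp add: spread_cone_def)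
    show "\<bar>spread_cone F n c x\<bar> \<le> B" for x
    proof -
      let ?w = "step_weight F (hd x) (hd (tl x))"
      have "1 / real (card F) \<le> 1" using F by (simp add: card_gt_0_iff Suc_leI)
      then have "\<bar>?w\<bar> \<le> 1"
        using step_weight_bounds[of F "hd x" "hd (tl x)"] by linarith
      then have "\<bar>?w * c (tl x)\<bar> \<le> 1 * B"
        unfolding abs_mult by (intro mult_mono controlled_chainD(2)[OF c]) auto
      then show ?thesis
        using controlled_chain_nonneg[OF c] by (simp add: spread_cone_def)
    qed
    show "inv a \<otimes> b \<in> ?E"
      if x: "spread_cone F n c x \<noteq> 0" and ab: "a \<in> set x" "b \<in> set x" for x a b
    proof -
      have t: "x \<in> uf_tuples (carrier G) (Suc n)" and w: "step_weight F (hd x) (hd (tl x)) \<noteq> 0"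
        and cx: "c (tl x) \<noteq> 0"
        using x by (auto simp: spread_cone_def split: if_splits)
      obtain v u s where xs: "x = v # u # s" and G: "set x \<subseteq> carrier G"
        using t by (auto simp: uf_tuples_def length_Suc_conv)
      define f where "f = inv u \<otimes> v"
      have car: "v \<in> carrier G" "u \<in> carrier G" "a \<in> carrier G" "b \<in> carrier G"
        using G xs ab by auto
      have f: "f \<in> F" using w xs by (auto simp: step_weight_def f_def split: if_splits)
      have fG: "f \<in> carrier G" using f F by blast
      have v: "v = u \<otimes> f" using car by (simp add: f_def mult_inv_mult_cancel)
      have steps: "inv p \<otimes> q \<in> E" if "p \<in> set (u # s)" "q \<in> set (u # s)" for p q
        using controlled_chainD(5)[OF c cx] that xs by simp
      consider "a = v" "b = v" | "a = v" "b \<in> set (u # s)" | "a \<in> set (u # s)" "b = v"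
        | "a \<in> set (u # s)" "b \<in> set (u # s)" using ab xs by auto
      then show ?thesis
      proof cases
        case 1
        then show ?thesis using car by simp
      next
        case 2
        have "inv a \<otimes> b = inv f \<otimes> (inv u \<otimes> b)"
          using 2 v car fG by (simp add: inv_mult_group m_assoc)
        moreover have "inv u \<otimes> b \<in> E" using steps 2 by auto
        ultimately show ?thesis using f by force
      next
        case 3
        have "inv a \<otimes> b = (inv a \<otimes> u) \<otimes> f"
          using 3 v car fG by (simp add: m_assoc)
        moreover have "inv a \<otimes> u \<in> E" using steps 3 by auto
        ultimately show ?thesis using f by force
      next
        case 4
        then show ?thesis using steps by blast
      qed
    qed
  qed
  then show ?thesis by blast
qed

text \<open>
  The three kinds of faces of \<open>K c\<close>: dropping the cone point gives back \<open>c\<close> because the weights of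
  the cone points sum to \<open>1\<close>, dropping the first vertex of the original simplex gives the term with
  \<open>step_weight F v a\<close>, and by the cycle condition all other faces add up to the term with
  \<open>step_weight F v u\<close>.
\<close>
lemma cycle_minus_boundary_spread_cone:
  assumes c: "controlled_chain G (Suc n) B E c"
    and cyc: "uf_boundary (carrier G) (Suc n) c = (\<lambda>y. 0)"
    and F: "finite F" "F \<noteq> {}" "F \<subseteq> carrier G"
    and y: "v # u # s \<in> uf_tuples (carrier G) (Suc n)"
  shows "c (v # u # s) - uf_boundary (carrier G) (Suc (Suc n)) (spread_cone F (Suc n) c) (v # u # s)
     = (\<Sum>a\<in>(\<lambda>e. u \<otimes> e) ` E. (step_weight F v a - step_weight F v u) * c (a # u # s))"
proof -
  let ?w = "step_weight F"
  let ?K = "spread_cone F (Suc n) c"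
  have car: "v \<in> carrier G" "u \<in> carrier G" and l: "length s = n" "set s \<subseteq> carrier G"
    using y by (auto simp: uf_tuples_def)
  obtain E' where K: "controlled_chain G (Suc (Suc n)) B E' ?K"
    using controlled_chain_spread_cone[OF c F] by blast
  \<comment> \<open>Large enough to compute \<open>\<partial> c\<close> at \<open>u # s\<close>, \<open>\<partial> K c\<close> at \<open>v # u # s\<close>, and the total weight at \<open>v\<close>.\<close>
  define A where "A = (\<lambda>e. u \<otimes> e) ` E \<union> (\<lambda>e. v \<otimes> e) ` E' \<union> (\<lambda>f. v \<otimes> f) ` F"
  have A: "finite A" "A \<subseteq> carrier G"
    using F controlled_chainD(3,4)[OF c] controlled_chainD(3,4)[OF K] car
    by (auto simp: A_def)
  have AE: "(\<lambda>e. u \<otimes> e) ` E \<subseteq> A" by (auto simp: A_def)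
  have w1: "(\<Sum>a\<in>A. ?w a v) = 1"
    by (rule sum_step_weight[OF F car(1) A]) (auto simp: A_def)
  have c0: "boundary_within A c (u # s) = 0"
    using uf_boundary_eq_boundary_within[OF c, of "u # s" u A] A(1) l AE cyc by simp
  have "uf_boundary (carrier G) (Suc (Suc n)) ?K (v # u # s) = boundary_within A ?K (v # u # s)"
    by (rule uf_boundary_eq_boundary_within[OF K, of _ v]) (use A(1) l in \<open>auto simp: A_def\<close>)
  also have "\<dots> = boundary_within A (\<lambda>x. ?w (hd x) (hd (tl x)) * c (tl x)) (v # u # s)"
    unfolding boundary_within_eq_alternating_sum
  proof (intro sum.cong refl arg_cong2[of _ _ _ _ "(*)"])
    fix j a assume "j \<in> {..length (v # u # s)}" "a \<in> A"
    then have "take j (v # u # s) @ a # drop j (v # u # s) \<in> uf_tuples (carrier G) (Suc (Suc n))"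
      using A(2) car l set_take_subset[of j "v # u # s"] set_drop_subset[of j "v # u # s"]
      by (auto simp: uf_tuples_def simp del: take_Cons' drop_Cons')
    then show "?K (take j (v # u # s) @ a # drop j (v # u # s))
      = ?w (hd (take j (v # u # s) @ a # drop j (v # u # s)))
          (hd (tl (take j (v # u # s) @ a # drop j (v # u # s))))
        * c (tl (take j (v # u # s) @ a # drop j (v # u # s)))"
      by (simp add: spread_cone_def)
  qed
  also have "\<dots> = c (v # u # s) + ?w v u * (\<Sum>a\<in>A. c (a # u # s)) - (\<Sum>a\<in>A. ?w v a * c (a # u # s))"
    by (simp only: boundary_within_cone w1 c0 mult_1 mult_zero_right diff_zero)
  finally have "c (v # u # s) - uf_boundary (carrier G) (Suc (Suc n)) ?K (v # u # s)
      = (\<Sum>a\<in>A. (?w v a - ?w v u) * c (a # u # s))"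
    by (simp add: left_diff_distrib sum_subtractf sum_distrib_left)
  also have "\<dots> = (\<Sum>a\<in>(\<lambda>e. u \<otimes> e) ` E. (?w v a - ?w v u) * c (a # u # s))"
  proof (rule sum.mono_neutral_right[OF A(1) AE], rule ballI)
    fix a assume a: "a \<in> A - (\<lambda>e. u \<otimes> e) ` E"
    then have "a = u \<otimes> (inv u \<otimes> a)"
      using car A(2) by (simp add: mult_inv_mult_cancel subset_iff)
    then have "inv u \<otimes> a \<notin> E" using a by blast
    then have "c (a # u # s) = 0" using controlled_chainD(5)[OF c, of "a # u # s" u a] by auto
    then show "(?w v a - ?w v u) * c (a # u # s) = 0" by simp
  qed
  finally show ?thesis .
qed

text \<open>
  The sum in the preceding formula has at most \<open>card E\<close> terms, regardless of \<open>F\<close>, and all weights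
  lie between \<open>0\<close> and \<open>1 / card F\<close>.
\<close>
lemma cycle_homologous_small:
  assumes c: "controlled_chain G (Suc n) B E c"
    and cyc: "uf_boundary (carrier G) (Suc n) c = (\<lambda>y. 0)"
    and "\<epsilon> > 0"
  obtains h B' E' where "controlled_chain G (Suc (Suc n)) B' E' h"
    "\<And>x. x \<in> uf_tuples (carrier G) (Suc n) \<Longrightarrow>
       \<bar>c x - uf_boundary (carrier G) (Suc (Suc n)) h x\<bar> \<le> \<epsilon>"
proof -
  let ?M = "real (card E) * B"
  obtain F where F: "finite F" "F \<noteq> {}" "F \<subseteq> carrier G"
    and FM: "F = carrier G \<or> ?M \<le> \<epsilon> * real (card F)"
  proof (cases "finite (carrier G)")
    case True
    show ?thesis by (rule that[of "carrier G"]) (use True one_closed in auto)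
  next
    case False
    obtain N where N: "?M / \<epsilon> \<le> real N" using real_arch_simple by blast
    obtain F where "finite F" "card F = Suc N" "F \<subseteq> carrier G"
      using infinite_arbitrarily_large[OF False] by metis
    then show ?thesis using N assms(3)
      by (intro that[of F]) (auto simp: field_simps)
  qed
  obtain E' where K: "controlled_chain G (Suc (Suc n)) B E' (spread_cone F (Suc n) c)"
    using controlled_chain_spread_cone[OF c F] by blast
  show ?thesis
  proof (rule that[OF K])
    fix x assume x: "x \<in> uf_tuples (carrier G) (Suc n)"
    then obtain v u s where xs: "x = v # u # s" and car: "v \<in> carrier G" "u \<in> carrier G"
      by (auto simp: uf_tuples_def length_Suc_conv)
    let ?w = "step_weight F" and ?A = "(\<lambda>e. u \<otimes> e) ` E"
    have B: "0 \<le> B" using controlled_chain_nonneg[OF c] .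
    have E: "finite E" "E \<subseteq> carrier G" using controlled_chainD(3,4)[OF c] by auto
    have eq: "c x - uf_boundary (carrier G) (Suc (Suc n)) (spread_cone F (Suc n) c) x
        = (\<Sum>a\<in>?A. (?w v a - ?w v u) * c (a # u # s))"
      using cycle_minus_boundary_spread_cone[OF c cyc F] x xs by simp
    show "\<bar>c x - uf_boundary (carrier G) (Suc (Suc n)) (spread_cone F (Suc n) c) x\<bar> \<le> \<epsilon>"
    proof (cases "F = carrier G")
      case True
      have "?w v a = ?w v u" if "a \<in> ?A" for a
        using that True car E by (auto simp: step_weight_def)
      then show ?thesis using eq assms(3) by simp
    next
      case False
      have "\<bar>\<Sum>a\<in>?A. (?w v a - ?w v u) * c (a # u # s)\<bar> \<le> (\<Sum>a\<in>?A. 1 / real (card F) * B)"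
      proof (rule order_trans[OF sum_abs sum_mono])
        fix a
        have "\<bar>?w v a - ?w v u\<bar> \<le> 1 / real (card F)"
          using step_weight_bounds[of F v a] step_weight_bounds[of F v u] by linarith
        then show "\<bar>(?w v a - ?w v u) * c (a # u # s)\<bar> \<le> 1 / real (card F) * B"
          unfolding abs_mult by (intro mult_mono controlled_chainD(2)[OF c]) auto
      qed
      also have "\<dots> = real (card ?A) * (B / real (card F))" by simp
      also have "\<dots> \<le> real (card E) * (B / real (card F))"
        using card_image_le[OF E(1), of "\<lambda>e. u \<otimes> e"] B by (intro mult_right_mono) auto
      also have "\<dots> \<le> \<epsilon>"
        using FM False F by (simp add: divide_le_eq card_gt_0_iff)
      finally show ?thesis using eq by simp
    qed
  qed
qed

end

section \<open>Vanishing of the semi-norm\<close>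

lemma uf_class_eq:
  "uf_class X d n c = {(\<lambda>x. b x + c x) | b. b \<in> uf_boundaries X d n}"
  by (auto simp: uf_class_def r_coset_def uf_cycle_group_def)

text \<open>
  One inclusion is enough, since \<open>c\<close> arises from \<open>c - \<partial> h\<close> by subtracting \<open>\<partial> (- h)\<close>.
\<close>
lemma (in group) uf_class_minus_boundary:
  fixes S :: "'a set" and c :: "'a list \<Rightarrow> real" and n :: nat
  defines "bnd \<equiv> uf_boundary (carrier G) (Suc n)" and "cls \<equiv> uf_class (carrier G) (word_dist G S) n"
  assumes S: "finite S" "S \<subseteq> carrier G" "generate G S = carrier G"
    and h: "h \<in> uf_chains (carrier G) (word_dist G S) (Suc n)"
  shows "cls (\<lambda>x. c x - bnd h x) = cls c"
proof
  note iff = uf_chains_iff_controlled[OF S]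
  have sub: "cls (\<lambda>x. c x - bnd h x) \<subseteq> cls c"
    if h: "h \<in> uf_chains (carrier G) (word_dist G S) (Suc n)" for h c
  proof
    fix z assume "z \<in> cls (\<lambda>x. c x - bnd h x)"
    then obtain e where e: "e \<in> uf_chains (carrier G) (word_dist G S) (Suc n)"
      and z: "z = (\<lambda>x. bnd e x + (c x - bnd h x))"
      by (auto simp: cls_def bnd_def uf_class_eq uf_boundaries_def)
    obtain B E B' E' where "controlled_chain G (Suc n) B E e" "controlled_chain G (Suc n) B' E' h"
      using e h iff by blast
    then have eh: "(\<lambda>x. e x - h x) \<in> uf_chains (carrier G) (word_dist G S) (Suc n)"
      and "bnd (\<lambda>x. e x - h x) = (\<lambda>x. bnd e x - bnd h x)"
      using controlled_chain_diff uf_boundary_diff iff unfolding bnd_def by blast+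
    then have "z = (\<lambda>x. bnd (\<lambda>x. e x - h x) x + c x)"
      using z by (simp add: fun_eq_iff)
    then show "z \<in> cls c" using eh by (auto simp: cls_def bnd_def uf_class_eq uf_boundaries_def)
  qed
  show "cls (\<lambda>x. c x - bnd h x) \<subseteq> cls c" using sub[OF h] .
  obtain B E where hB: "controlled_chain G (Suc n) B E h" using h iff by blast
  have zero: "controlled_chain G (Suc n) 0 {} (\<lambda>x. 0)" by (simp add: controlled_chain_def)
  have "bnd (\<lambda>x. 0) = (\<lambda>y. 0)" by (simp add: bnd_def uf_boundary_def)
  then have neg: "bnd (\<lambda>x. 0 - h x) = (\<lambda>y. - bnd h y)"
    using uf_boundary_diff[OF zero hB] by (simp add: bnd_def)
  have "(\<lambda>x. 0 - h x) \<in> uf_chains (carrier G) (word_dist G S) (Suc n)"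
    using controlled_chain_diff[OF zero hB] iff by blast
  from sub[OF this, of "\<lambda>x. c x - bnd h x"]
  show "cls c \<subseteq> cls (\<lambda>x. c x - bnd h x)"
    using neg by simp
qed

lemma uf_norm_nonneg:
  assumes "c \<in> uf_chains X d n" "X \<noteq> {}"
  shows "0 \<le> uf_norm X n c"
proof -
  obtain p where "p \<in> X" using assms(2) by blast
  then have p: "replicate (Suc n) p \<in> uf_tuples X n" by (auto simp: uf_tuples_def)
  obtain B where "\<forall>x\<in>uf_tuples X n. \<bar>c x\<bar> \<le> B" using assms(1) by (auto simp: uf_chains_def)
  then have "bdd_above ((\<lambda>x. \<bar>c x\<bar>) ` uf_tuples X n)" by (intro bdd_aboveI[of _ B]) auto
  then have "\<bar>c (replicate (Suc n) p)\<bar> \<le> uf_norm X n c"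
    unfolding uf_norm_def by (rule cSUP_upper[OF p])
  then show ?thesis by linarith
qed

theorem proposition1p3:
  fixes G :: "('a, 'b) monoid_scheme" and S :: "'a set" and k :: nat
  assumes "group G"
    and "finite S" and "S \<subseteq> carrier G" and "generate G S = carrier G"
    and "amenable G"
    and "k > 0"
  shows "\<forall>\<alpha>\<in>carrier (uf_homology (carrier G) (word_dist G S) k).
           uf_seminorm (carrier G) (word_dist G S) k \<alpha> = 0"
proof
  interpret group G by fact
  let ?X = "carrier G" and ?d = "word_dist G S"
  note iff = uf_chains_iff_controlled[OF assms(2-4)]
  obtain n where k: "k = Suc n" using assms(6) by (cases k) auto
  have ne: "?X \<noteq> {}" using one_closed by blast
  have ex_tuple: "replicate (Suc k) \<one>\<^bsub>G\<^esub> \<in> uf_tuples ?X k" by (auto simp: uf_tuples_def)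
  fix \<alpha> assume "\<alpha> \<in> carrier (uf_homology ?X ?d k)"
  then obtain c where c: "c \<in> uf_cycles ?X ?d k" and \<alpha>: "\<alpha> = uf_class ?X ?d k c"
    by (auto simp: uf_homology_def FactGroup_def RCOSETS_def uf_class_def uf_cycle_group_def)
  obtain B E where cE: "controlled_chain G (Suc n) B E c"
    using c iff by (auto simp: uf_cycles_def k)
  have cyc: "uf_boundary ?X (Suc n) c = (\<lambda>y. 0)" using c by (simp add: uf_cycles_def k)
  let ?N = "{uf_norm ?X k c' | c'. c' \<in> uf_cycles ?X ?d k \<and> uf_class ?X ?d k c' = \<alpha>}"
  have nonneg: "0 \<le> r" if "r \<in> ?N" for r
    using that uf_norm_nonneg[OF _ ne] by (auto simp: uf_cycles_def)
  have small: "\<exists>r\<in>?N. r \<le> \<epsilon>" if pos: "\<epsilon> > 0" for \<epsilon>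
  proof -
    obtain h Bh Eh where h: "controlled_chain G (Suc (Suc n)) Bh Eh h"
      and le: "\<And>x. x \<in> uf_tuples ?X (Suc n) \<Longrightarrow> \<bar>c x - uf_boundary ?X (Suc (Suc n)) h x\<bar> \<le> \<epsilon>"
      by (rule cycle_homologous_small[OF cE cyc pos], rule that)
    define c' where "c' = (\<lambda>x. c x - uf_boundary ?X (Suc (Suc n)) h x)"
    obtain B' where dh: "controlled_chain G (Suc n) B' Eh (uf_boundary ?X (Suc (Suc n)) h)"
      using controlled_chain_boundary[OF h] by blast
    have "c' \<in> uf_chains ?X ?d k"
      using controlled_chain_diff[OF cE dh] iff unfolding c'_def k by blast
    moreover have "uf_boundary ?X k c' = (\<lambda>y. 0)"
      unfolding c'_def k uf_boundary_diff[OF cE dh] cyc uf_boundary_boundary[OF h] by simp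
    ultimately have c'_cycle: "c' \<in> uf_cycles ?X ?d k" by (simp add: uf_cycles_def)
    have cls: "uf_class ?X ?d k c' = \<alpha>"
      unfolding \<alpha> c'_def k by (rule uf_class_minus_boundary[OF assms(2-4)]) (use h iff in blast)
    have "uf_norm ?X k c' \<le> \<epsilon>"
      unfolding uf_norm_def
    proof (rule cSUP_least)
      show "uf_tuples ?X k \<noteq> {}"
        using ex_tuple by blast
    next
      show "\<bar>c' x\<bar> \<le> \<epsilon>" if "x \<in> uf_tuples ?X k" for x
        using le[of x] that unfolding c'_def k .
    qed
    moreover have "uf_norm ?X k c' \<in> ?N" using c'_cycle cls by blast
    ultimately show ?thesis by (rule bexI)
  qed
  have bdd: "bdd_below ?N" using nonneg by (rule bdd_belowI)
  have "Inf ?N \<le> 0"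
  proof (rule field_le_epsilon)
    fix \<epsilon> :: real assume "0 < \<epsilon>"
    from small[OF this] obtain r where "r \<in> ?N" "r \<le> \<epsilon>" by (rule bexE)
    then show "Inf ?N \<le> 0 + \<epsilon>" using cInf_lower[OF _ bdd, of r] by linarith
  qed
  moreover have "0 \<le> Inf ?N"
  proof (rule cInf_greatest)
    show "?N \<noteq> {}" using small[of 1] by auto
  qed (rule nonneg)
  ultimately have "Inf ?N = 0" by (rule order_antisym)
  then show "uf_seminorm ?X ?d k \<alpha> = 0" unfolding uf_seminorm_def .
qed

end
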